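(* Let $d\ge1$ and let $K\colon\mathbb{R}^d\to[0,+\infty)$ be given by $K(h)=\bar K(|h|)$, where $\bar K\colon[0,+\infty)\to[0,+\infty)$ is measurable and strictly decreasing, and suppose that $h\mapsto K(h)\min\{1,|h|\}$ belongs to $L^1(\mathbb{R}^d)$. Let $E\subset\mathbb{R}^d$ be measurable, and consider the two conditions $$\text{(a)}\quad L_K(E,F)\le L_K(E^c\cap F^c,F)\quad\text{for every measurable }F\subset E^c\cap U,$$ $$\text{(b)}\quad L_K(E^c,F)\le L_K(E\cap F^c,F)\quad\text{for every measurable }F\subset E\cap U.$$ (i) If (a) holds and $H\cap U^c\subset E$, then $H\subset E$ up to a set of measure zero. (ii) If (b) holds and $E\cap U^c\subset H$, then $E\subset H$ up to a set of measure zero. Statements (i) and (ii) also hold true with $H$ replaced by $H^c$. Moreover, if $E$ is a minimiser for the problem $$\inf\{\operatorname{Per}_K(F,U):\ F\subset\mathbb{R}^d\text{ measurable},\ F\cap U^c=H\cap U^c\},$$ then $|E\triangle H|=0$.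
   Context: $H=\{x=(x_1,\dots,x_d)\in\mathbb{R}^d: x_d<0\}$ and $U=(-\frac12,\frac12)^d$. For measurable sets $A,B\subset\mathbb{R}^d$, $L_K(A,B)=\int_B\int_AK(y-x)\,\mathrm{d}y\,\mathrm{d}x\in[0,+\infty]$; $A^c$ is the complement of $A$ in $\mathbb{R}^d$, $|A|$ its Lebesgue measure, $\triangle$ the symmetric difference. For a measurable set $\Omega$, $$\operatorname{Per}_K(E,\Omega)=L_K(E\cap\Omega,E^c\cap\Omega)+L_K(E\cap\Omega,E^c\cap\Omega^c)+L_K(E\cap\Omega^c,E^c\cap\Omega).$$
   Formalization: The dimension is taken to be d ≥ 2 instead of d ≥ 1: for d = 1 every part fails, e.g. E = (-∞,-1/2] satisfies (a), agrees with H outside U and is a minimiser, yet |H \ E| = 1/2. *)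

theory Defs
  imports "HOL-Analysis.Analysis"
begin

text \<open>
  The index type \<^typ>\<open>'n\<close> of \<^typ>\<open>real ^ 'n\<close> is unordered, so the index \<open>k\<close> that plays the
  role of the last coordinate \<open>x\<^sub>d\<close> is a parameter.  Measurable means Lebesgue measurable
  throughout; sets are compared literally except where null sets are mentioned.

  The dimension \<open>d = 1\<close> is excluded: there the complement of the open cube pins the half-line
  \<open>{x. x < 0}\<close> only up to \<open>x \<le> - 1/2\<close>, and \<open>E = {x. x \<le> - 1/2}\<close> satisfies both
  one-sided conditions below, agrees with the half-line outside the cube and has the same
  perimeter in the cube, but differs from the half-line by a set of measure \<open>1/2\<close>.
\<close>

definition half_space :: "'n \<Rightarrow> (real ^ 'n) set" where
  "half_space k = {x. x $ k < 0}"

definition unit_cube :: "(real ^ 'n) set" where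
  "unit_cube = {x. \<forall>i. - 1/2 < x $ i \<and> x $ i < 1/2}"

definition interaction ::
    "(real ^ 'n \<Rightarrow> real) \<Rightarrow> (real ^ 'n) set \<Rightarrow> (real ^ 'n) set \<Rightarrow> ennreal" where
  "interaction K A B =
     (\<integral>\<^sup>+x\<in>B. (\<integral>\<^sup>+y\<in>A. ennreal (K (y - x)) \<partial>lebesgue) \<partial>lebesgue)"

definition nonlocal_per ::
    "(real ^ 'n \<Rightarrow> real) \<Rightarrow> (real ^ 'n) set \<Rightarrow> (real ^ 'n) set \<Rightarrow> ennreal" where
  "nonlocal_per K E \<Omega> =
     interaction K (E \<inter> \<Omega>) (- E \<inter> \<Omega>)
     + interaction K (E \<inter> \<Omega>) (- E \<inter> - \<Omega>)
     + interaction K (E \<inter> - \<Omega>) (- E \<inter> \<Omega>)"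

definition outer_condition ::
    "(real ^ 'n \<Rightarrow> real) \<Rightarrow> (real ^ 'n) set \<Rightarrow> (real ^ 'n) set \<Rightarrow> bool" where
  "outer_condition K U E \<longleftrightarrow>
     (\<forall>F \<in> sets lebesgue. F \<subseteq> - E \<inter> U \<longrightarrow> interaction K E F \<le> interaction K (- E \<inter> - F) F)"

definition inner_condition ::
    "(real ^ 'n \<Rightarrow> real) \<Rightarrow> (real ^ 'n) set \<Rightarrow> (real ^ 'n) set \<Rightarrow> bool" where
  "inner_condition K U E \<longleftrightarrow>
     (\<forall>F \<in> sets lebesgue. F \<subseteq> E \<inter> U \<longrightarrow> interaction K (- E) F \<le> interaction K (E \<inter> - F) F)"

end

theory Submission
  imports Defs
begin

text \<open>
  Why half-spaces win: let \<open>F = H - E\<close> be what \<open>E\<close> misses of the half-space.  Since \<open>E\<close> contains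
  \<open>H\<close> outside the cube, \<open>F\<close> lies in the cube.  Testing the one-sided condition with \<open>F\<close> itself and
  using that \<open>E\<close> contains \<open>H - F\<close> and that \<open>- E \<inter> - F\<close> avoids \<open>H\<close> gives the single
  inequality \<open>L(H - F, F) \<le> L(- H, F)\<close>.

  Sort the interactions of \<open>F\<close> by the displacement \<open>h = y - x\<close>.  Tonelli gives
  \<open>L(A, B) = \<integral> K(h) |{x \<in> B. x + h \<in> A}| dh\<close>
  (\<open>interaction_eq_overlap_integral\<close>), and for a set \<open>F\<close> of finite measure
  \<open>|{x \<in> F. x + h \<notin> F}|\<close> is even in \<open>h\<close> (\<open>overlap_complement_even\<close>).  Call \<open>h\<close> inward if adding
  it moves towards the inside of \<open>H\<close>, and outward if \<open>- h\<close> is inward.  As \<open>K\<close> is even, the interaction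
  of \<open>F\<close> with its complement along inward \<open>h\<close> equals that along outward \<open>h\<close>.  Inward displacements
  never leave \<open>H\<close>, while outward ones may land in \<open>H - F\<close> or in \<open>- H\<close>.  Writing \<open>\<beta>\<close> for the
  interaction of \<open>F\<close> with \<open>H - F\<close> along outward \<open>h\<close>, this reads
  \<open>L(inward part) = \<beta> + L(- H, F)\<close>.  The hypothesis bounds \<open>\<beta> + L(inward part)\<close> by \<open>L(- H, F)\<close>, so
  \<open>2 \<beta> + L(- H, F) \<le> L(- H, F)\<close>.  The right side is finite
  (\<open>interaction_half_space_finite\<close>), because a displacement \<open>h\<close> takes out of \<open>H\<close> only a slab of
  the cube of thickness at most \<open>|h|\<close>, which is what the weight \<open>min 1 |h|\<close> controls.  Hence
  \<open>\<beta> = 0\<close>.  Strict positivity of \<open>K\<close> turns this into a statement on almost every outward \<open>h\<close>, and the choice of an \<open>h\<close> that leaves the cube sideways but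
  is only slightly outward shows that \<open>F\<close> is null (\<open>half_space_defect_null\<close>).  The sideways
  direction is where dimension at least two enters.

  The remaining one-sided statements follow by passing to complements and by reversing the direction
  of the half-space.  A minimiser has finite perimeter, because the half-space does, and adding
  to or removing from it a subset of the cube yields both one-sided conditions
  (\<open>outer_condition_of_minimal\<close>).
\<close>

section \<open>Overlap of a set with a translate\<close>

definition overlap :: "'a::euclidean_space set \<Rightarrow> 'a set \<Rightarrow> 'a \<Rightarrow> ennreal" where
  "overlap A B h = emeasure lebesgue {x \<in> B. x + h \<in> A}"

lemma translated_lebesgue_set:
  fixes A :: "'a::euclidean_space set"
  assumes "A \<in> sets lebesgue"
  shows "{x. x + h \<in> A} \<in> sets lebesgue"
proof -
  have "{x. x + h \<in> A} = (+) (- h) ` A"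
    by (force simp: image_iff algebra_simps)
  then show ?thesis
    using lebesgue_sets_translation[OF assms, of "- h"] by simp
qed

lemma overlap_set_measurable:
  fixes A B :: "'a::euclidean_space set"
  assumes "A \<in> sets lebesgue" "B \<in> sets lebesgue"
  shows "{x \<in> B. x + h \<in> A} \<in> sets lebesgue"
  using sets.Int[OF assms(2) translated_lebesgue_set[OF assms(1), of h]] by (simp add: Int_def)

lemma overlap_Un_left:
  assumes "A \<in> sets lebesgue" "A' \<in> sets lebesgue" "B \<in> sets lebesgue" "A \<inter> A' = {}"
  shows "overlap (A \<union> A') B h = overlap A B h + overlap A' B h"
proof -
  have "{x \<in> B. x + h \<in> A \<union> A'} = {x \<in> B. x + h \<in> A} \<union> {x \<in> B. x + h \<in> A'}" by auto
  then show ?thesis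
    unfolding overlap_def using assms
    by (subst plus_emeasure) (auto intro!: overlap_set_measurable)
qed

lemma overlap_swap:
  fixes A B :: "'a::euclidean_space set"
  shows "overlap A B (- h) = overlap B A h"
proof -
  have "{x \<in> B. x + - h \<in> A} = (+) h ` {x \<in> A. x + h \<in> B}"
    by (force simp: image_iff algebra_simps)
  then show ?thesis
    using emeasure_lebesgue_affine[of 1 h "{x \<in> A. x + h \<in> B}"]
    by (simp add: overlap_def add.commute image_def)
qed

text \<open>
  The covariogram \<open>|F \<inter> (F - h)|\<close> is even, and its complement in \<open>|F|\<close> inherits this; finiteness of
  \<open>|F|\<close> is needed to subtract.  Having the symmetry for each \<open>h\<close> separately avoids cancelling the
  interaction of \<open>F\<close> with itself, which may be infinite.
\<close>

lemma overlap_complement_even: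
  fixes F :: "'a::euclidean_space set"
  assumes F: "F \<in> sets lebesgue" and fin: "emeasure lebesgue F < \<infinity>"
  shows "overlap (- F) F (- h) = overlap (- F) F h"
proof -
  have fixed_total: "overlap F F h + overlap (- F) F h = emeasure lebesgue F" for h
    using overlap_Un_left[of F "- F" F h] F by (simp add: overlap_def Compl_in_sets_lebesgue)
  have "overlap F F h \<le> emeasure lebesgue F" using fixed_total[of h] by (metis le_iff_add)
  then have "overlap F F h \<noteq> top" using fin by (auto simp: top_unique)
  moreover have "overlap F F h + overlap (- F) F (- h) = overlap F F h + overlap (- F) F h"
    using fixed_total[of h] fixed_total[of "- h"] overlap_swap[of F F h] by simp
  ultimately show ?thesis by (simp add: ennreal_add_left_cancel)
qed

section \<open>Interactions as integrals over displacements\<close>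

text \<open>
  Tonelli's theorem asks for joint measurability of \<open>(x, h) \<mapsto> indicator A (x + h)\<close> in the product
  \<open>\<sigma>\<close>-algebra, which is immediate when \<open>A\<close> is Borel.  A Lebesgue set is therefore first replaced by a
  Borel set that agrees with it almost everywhere.
\<close>

lemma lebesgue_set_borel_version:
  fixes A :: "'a::euclidean_space set"
  assumes "A \<in> sets lebesgue"
  obtains A' where "A' \<in> sets borel" "AE x in lborel. x \<in> A \<longleftrightarrow> x \<in> A'"
proof -
  obtain S N N' where *: "A = S \<union> N" "N \<subseteq> N'" "N' \<in> null_sets lborel" "S \<in> sets lborel"
    using sets_completionE[OF assms] .
  have "AE x in lborel. x \<notin> N'" using *(3) by (rule AE_not_in)
  then have "AE x in lborel. x \<in> A \<longleftrightarrow> x \<in> S" using *(1,2) by (auto elim!: eventually_mono)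
  then show thesis using that[of S] * by simp
qed

lemma nn_integral_lborel_translate:
  fixes f :: "'a::euclidean_space \<Rightarrow> ennreal"
  assumes [measurable]: "f \<in> borel_measurable borel"
  shows "(\<integral>\<^sup>+y. f y \<partial>lborel) = (\<integral>\<^sup>+h. f (x + h) \<partial>lborel)"
proof -
  have "(\<integral>\<^sup>+y. f y \<partial>lborel) = (\<integral>\<^sup>+y. f y \<partial>distr lborel borel ((+) x))"
    by (simp add: lborel_distr_plus)
  also have "\<dots> = (\<integral>\<^sup>+h. f (x + h) \<partial>lborel)" by (subst nn_integral_distr) simp_all
  finally show ?thesis .
qed

lemma nn_integral_lborel_reflect:
  fixes f :: "'a::euclidean_space \<Rightarrow> ennreal"
  assumes [measurable]: "f \<in> borel_measurable borel"
  shows "(\<integral>\<^sup>+h. f (- h) \<partial>lborel) = (\<integral>\<^sup>+h. f h \<partial>lborel)"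
proof -
  have "lborel = distr lborel borel (\<lambda>x::'a. - x)"
    using lborel_affine[of "-1" "0::'a"] by (simp add: density_1)
  then have "(\<integral>\<^sup>+h. f h \<partial>lborel) = (\<integral>\<^sup>+h. f h \<partial>distr lborel borel (\<lambda>x::'a. - x))" by simp
  also have "\<dots> = (\<integral>\<^sup>+h. f (- h) \<partial>lborel)" by (subst nn_integral_distr) simp_all
  finally show ?thesis by simp
qed

lemma AE_lborel_translate:
  fixes P :: "'a::euclidean_space \<Rightarrow> bool"
  assumes "AE x in lborel. P x"
  shows "AE x in lborel. P (x + h)"
proof -
  have "AE x in distr lborel borel ((+) h). P x" using assms by (subst lborel_distr_plus)
  then have "AE x in lborel. P (h + x)" by (rule AE_distrD[rotated]) simp
  then show ?thesis by (simp add: add.commute)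
qed

lemma overlap_borel_version:
  fixes A B A' B' :: "'a::euclidean_space set"
  assumes A': "A' \<in> sets borel" "AE x in lborel. x \<in> A \<longleftrightarrow> x \<in> A'"
    and B': "B' \<in> sets borel" "AE x in lborel. x \<in> B \<longleftrightarrow> x \<in> B'"
    and m: "A \<in> sets lebesgue" "B \<in> sets lebesgue"
  shows "overlap A B h = (\<integral>\<^sup>+x. indicator B' x * indicator A' (x + h) \<partial>lborel)"
proof -
  have "overlap A B h = (\<integral>\<^sup>+x. indicator {x \<in> B. x + h \<in> A} x \<partial>lborel)"
    using nn_integral_indicator[OF overlap_set_measurable[OF m, of h]]
    by (simp only: overlap_def nn_integral_completion)
  also have "\<dots> = (\<integral>\<^sup>+x. indicator B' x * indicator A' (x + h) \<partial>lborel)"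
    using AE_lborel_translate[OF A'(2), of h] B'(2)
    by (intro nn_integral_cong_AE, eventually_elim) (auto simp: indicator_def)
  finally show ?thesis .
qed

lemma borel_measurable_overlap:
  fixes A B :: "'a::euclidean_space set"
  assumes "A \<in> sets lebesgue" "B \<in> sets lebesgue"
  shows "overlap A B \<in> borel_measurable borel"
proof -
  obtain A' where A': "A' \<in> sets borel" "AE x in lborel. x \<in> A \<longleftrightarrow> x \<in> A'"
    using lebesgue_set_borel_version[OF assms(1)] .
  obtain B' where B': "B' \<in> sets borel" "AE x in lborel. x \<in> B \<longleftrightarrow> x \<in> B'"
    using lebesgue_set_borel_version[OF assms(2)] .
  note [measurable] = A'(1) B'(1)
  have "overlap A B = (\<lambda>h. \<integral>\<^sup>+x. indicator B' x * indicator A' (x + h) \<partial>lborel)"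
    using overlap_borel_version[OF A' B' assms] by auto
  also have "\<dots> \<in> borel_measurable borel" by measurable
  finally show ?thesis .
qed

text \<open>
  Substitute \<open>y = x + h\<close> and integrate in \<open>x\<close> first.  After this, all additivity and symmetry
  properties of interactions are pointwise properties of \<^const>\<open>overlap\<close> in \<open>h\<close>.
\<close>

lemma interaction_eq_overlap_integral:
  fixes A B :: "(real ^ 'n) set"
  assumes K[measurable]: "K \<in> borel_measurable borel"
    and m: "A \<in> sets lebesgue" "B \<in> sets lebesgue"
  shows "interaction K A B = (\<integral>\<^sup>+h. ennreal (K h) * overlap A B h \<partial>lborel)"
proof -
  obtain A' where A': "A' \<in> sets borel" "AE x in lborel. x \<in> A \<longleftrightarrow> x \<in> A'"
    using lebesgue_set_borel_version[OF m(1)] .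
  obtain B' where B': "B' \<in> sets borel" "AE x in lborel. x \<in> B \<longleftrightarrow> x \<in> B'"
    using lebesgue_set_borel_version[OF m(2)] .
  note [measurable] = A'(1) B'(1)
  have inner: "(\<integral>\<^sup>+y\<in>A. ennreal (K (y - x)) \<partial>lebesgue)
      = (\<integral>\<^sup>+h. ennreal (K h) * indicator A' (x + h) \<partial>lborel)" for x
  proof -
    have "(\<integral>\<^sup>+y\<in>A. ennreal (K (y - x)) \<partial>lebesgue) = (\<integral>\<^sup>+y. ennreal (K (y - x)) * indicator A' y \<partial>lborel)"
      unfolding nn_integral_completion
      using A'(2) by (intro nn_integral_cong_AE, eventually_elim) (auto simp: indicator_def)
    also have "\<dots> = (\<integral>\<^sup>+h. ennreal (K h) * indicator A' (x + h) \<partial>lborel)"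
      by (subst nn_integral_lborel_translate[of _ x]) simp_all
    finally show ?thesis .
  qed
  have "interaction K A B = (\<integral>\<^sup>+x. (\<integral>\<^sup>+h. ennreal (K h) * indicator A' (x + h) \<partial>lborel) * indicator B' x \<partial>lborel)"
    unfolding interaction_def inner unfolding nn_integral_completion
    using B'(2) by (intro nn_integral_cong_AE, eventually_elim) (auto simp: indicator_def)
  also have "\<dots> = (\<integral>\<^sup>+x. (\<integral>\<^sup>+h. ennreal (K h) * (indicator B' x * indicator A' (x + h)) \<partial>lborel) \<partial>lborel)"
    by (intro nn_integral_cong, subst nn_integral_multc[symmetric]) (simp_all add: ac_simps)
  also have "\<dots> = (\<integral>\<^sup>+h. (\<integral>\<^sup>+x. ennreal (K h) * (indicator B' x * indicator A' (x + h)) \<partial>lborel) \<partial>lborel)"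
    by (rule lborel_pair.Fubini') measurable
  also have "\<dots> = (\<integral>\<^sup>+h. ennreal (K h) * overlap A B h \<partial>lborel)"
    by (simp add: overlap_borel_version[OF A' B' m] nn_integral_cmult)
  finally show ?thesis .
qed

lemma interaction_mono:
  fixes A B A' B' :: "(real ^ 'n) set"
  assumes "A \<subseteq> A'" "B \<subseteq> B'"
  shows "interaction K A B \<le> interaction K A' B'"
  unfolding interaction_def using assms
  by (intro nn_integral_mono mult_mono) (auto simp: indicator_def)

lemma interaction_commute:
  fixes A B :: "(real ^ 'n) set"
  assumes K[measurable]: "K \<in> borel_measurable borel" and even: "\<And>h. K (- h) = K h"
    and m: "A \<in> sets lebesgue" "B \<in> sets lebesgue"
  shows "interaction K A B = interaction K B A"
proof -
  note [measurable] = borel_measurable_overlap[OF m]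
  have "interaction K A B = (\<integral>\<^sup>+h. ennreal (K (- h)) * overlap A B (- h) \<partial>lborel)"
    unfolding interaction_eq_overlap_integral[OF K m]
    by (rule nn_integral_lborel_reflect[symmetric]) measurable
  then show ?thesis
    by (simp add: even overlap_swap interaction_eq_overlap_integral[OF K m(2,1)])
qed

lemma interaction_Un_left:
  fixes A A' B :: "(real ^ 'n) set"
  assumes K[measurable]: "K \<in> borel_measurable borel"
    and m: "A \<in> sets lebesgue" "A' \<in> sets lebesgue" "B \<in> sets lebesgue" and disj: "A \<inter> A' = {}"
  shows "interaction K (A \<union> A') B = interaction K A B + interaction K A' B"
proof -
  note [measurable] = borel_measurable_overlap[OF m(1,3)] borel_measurable_overlap[OF m(2,3)]
  show ?thesis
    by (simp add: interaction_eq_overlap_integral[OF K] m sets.Un overlap_Un_left[OF m disj]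
        distrib_left nn_integral_add)
qed

lemma interaction_Un_right:
  fixes A B B' :: "(real ^ 'n) set"
  assumes K: "K \<in> borel_measurable borel" and even: "\<And>h. K (- h) = K h"
    and m: "A \<in> sets lebesgue" "B \<in> sets lebesgue" "B' \<in> sets lebesgue" and disj: "B \<inter> B' = {}"
  shows "interaction K A (B \<union> B') = interaction K A B + interaction K A B'"
proof -
  have "interaction K A (B \<union> B') = interaction K (B \<union> B') A"
    by (rule interaction_commute[OF K even]) (auto intro: m sets.Un)
  also have "\<dots> = interaction K B A + interaction K B' A"
    by (rule interaction_Un_left[OF K m(2,3,1) disj])
  also have "\<dots> = interaction K A B + interaction K A B'"
    using interaction_commute[OF K even m(2,1)] interaction_commute[OF K even m(3,1)] by simp
  finally show ?thesis .
qed

section \<open>Half-spaces have finite interaction with the cube\<close>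

text \<open>
  The sign of \<open>s\<close> chooses the side.  Open and closed half-spaces are both admitted so that the class
  is closed under complements.
\<close>

definition coordinate_half_space :: "'n::finite \<Rightarrow> real \<Rightarrow> (real ^ 'n) set \<Rightarrow> bool" where
  "coordinate_half_space k s H \<longleftrightarrow> H = {x. s * x $ k < 0} \<or> H = {x. s * x $ k \<le> 0}"

lemma coordinate_half_space_lebesgue:
  "coordinate_half_space k s H \<Longrightarrow> H \<in> sets lebesgue"
  unfolding coordinate_half_space_def by (auto intro!: sets_completionI_sets)

lemma unit_cube_lebesgue: "(unit_cube :: (real ^ 'n::finite) set) \<in> sets lebesgue"
proof -
  have "(unit_cube :: (real ^ 'n) set) = box (\<chi> i. - 1/2) (\<chi> i. 1/2)"
    by (auto simp: unit_cube_def mem_box_cart)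
  then show ?thesis by (metis borel_open open_box sets_completionI_sets sets_lborel)
qed

text \<open>
  All sides of the enclosing box but the \<open>k\<close>-th have length \<open>1\<close>.  The minimum with \<open>1\<close> is the form that
  matches the weight \<open>min 1 |h|\<close>.
\<close>

lemma emeasure_unit_cube_slab:
  fixes k :: "'n::finite"
  assumes F: "\<And>x. x \<in> F \<Longrightarrow> x \<in> unit_cube \<and> \<bar>x $ k\<bar> \<le> t" and "t \<ge> 0"
  shows "emeasure lebesgue F \<le> ennreal (2 * min 1 t)"
proof -
  define m where "m = min 1 t"
  define u :: "real ^ 'n" where "u = (\<chi> i. if i = k then m else 1/2)"
  have m: "m \<ge> 0" using assms by (simp add: m_def)
  have "F \<subseteq> cbox (- u) u"
  proof
    fix x assume "x \<in> F"
    then have *: "- 1/2 < x $ i \<and> x $ i < 1/2" "\<bar>x $ k\<bar> \<le> t" for i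
      using F by (auto simp: unit_cube_def)
    have "\<bar>x $ i\<bar> \<le> u $ i" for i
      using *(1)[of i] *(2) by (auto simp: u_def m_def)
    then show "x \<in> cbox (- u) u" by (simp add: mem_box_cart abs_le_iff minus_le_iff)
  qed
  then have "emeasure lebesgue F \<le> emeasure lebesgue (cbox (- u) u)"
    by (intro emeasure_mono) auto
  also have "\<dots> = ennreal (measure lborel (cbox (- u) u))"
    using emeasure_lborel_cbox_finite[of "- u" u] by (simp add: emeasure_eq_ennreal_measure)
  also have "measure lborel (cbox (- u) u) = (\<Prod>i\<in>UNIV. u $ i - (- u) $ i)"
    using m by (intro content_cbox_cart) (auto simp: interval_ne_empty_cart u_def)
  also have "\<dots> = (\<Prod>i\<in>UNIV. if i = k then 2 * m else 1)"
    by (intro prod.cong) (auto simp: u_def)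
  also have "\<dots> = 2 * m" by simp
  finally show ?thesis by (simp add: m_def)
qed

text \<open>
  If \<open>x \<in> H\<close> and \<open>x + h \<notin> H\<close>, then \<open>x\<close> is within \<open>|h|\<close> of the boundary of \<open>H\<close>.  The measure of such
  points in the cube is at most \<open>2 min 1 |h|\<close>, and this compensates the singularity of the kernel at
  the origin.
\<close>

lemma interaction_half_space_finite:
  fixes k :: "'n::finite"
  assumes K: "K \<in> borel_measurable borel" and Kpos: "\<And>h. K h > 0"
    and K_int: "integrable lebesgue (\<lambda>h. K h * min 1 (norm h))"
    and H: "coordinate_half_space k s H" and s: "s \<noteq> 0"
    and F: "F \<in> sets lebesgue" "F \<subseteq> unit_cube \<inter> H"
  shows "interaction K (- H) F < \<infinity>"
proof -
  note Hm = coordinate_half_space_lebesgue[OF H]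
  have slab: "overlap (- H) F h \<le> ennreal (2 * min 1 (norm h))" for h
    unfolding overlap_def
  proof (rule emeasure_unit_cube_slab[where k = k])
    fix x assume "x \<in> {x \<in> F. x + h \<in> - H}"
    then have x: "x \<in> F" "x \<in> unit_cube" "x \<in> H" "x + h \<notin> H" using F(2) by auto
    have "s * x $ k \<le> 0" "s * x $ k + s * h $ k \<ge> 0"
      using H x by (auto simp: coordinate_half_space_def distrib_left)
    then have "\<bar>s * x $ k\<bar> \<le> \<bar>s * h $ k\<bar>" by linarith
    then have "\<bar>x $ k\<bar> \<le> \<bar>h $ k\<bar>" using s by (simp add: abs_mult)
    also have "\<dots> \<le> norm h" by (rule component_le_norm_cart)
    finally show "x \<in> unit_cube \<and> \<bar>x $ k\<bar> \<le> norm h" using x by simp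
  qed simp
  have "interaction K (- H) F = (\<integral>\<^sup>+h. ennreal (K h) * overlap (- H) F h \<partial>lborel)"
    using Hm by (intro interaction_eq_overlap_integral K F) (simp add: Compl_in_sets_lebesgue)
  also have "\<dots> \<le> (\<integral>\<^sup>+h. ennreal (K h) * ennreal (2 * min 1 (norm h)) \<partial>lborel)"
    by (intro nn_integral_mono mult_left_mono slab) simp
  also have "\<dots> = (\<integral>\<^sup>+h. ennreal (2 * (K h * min 1 (norm h))) \<partial>lebesgue)"
    unfolding nn_integral_completion
    by (intro nn_integral_cong) (simp add: less_imp_le[OF Kpos] ac_simps flip: ennreal_mult)
  also have "\<dots> < \<infinity>"
    using integrableD(2)[OF integrable_mult_right[OF K_int, of 2]] less_imp_le[OF Kpos]
    by (simp add: abs_mult less_top)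
  finally show ?thesis .
qed

section \<open>A half-space cannot have a defect inside the cube\<close>

lemma AE_lborel_open_ex:
  fixes S :: "'a::euclidean_space set"
  assumes "AE x in lborel. P x" "open S" "S \<noteq> {}"
  shows "\<exists>x\<in>S. P x"
proof (rule ccontr)
  assume "\<not> ?thesis"
  then have "AE x in lborel. x \<notin> S" using assms(1) by (auto elim!: eventually_mono)
  then have "S \<in> null_sets lborel" using assms(2) by (simp add: AE_iff_null_sets)
  then have "negligible S" by (simp add: negligible_iff_null_sets null_sets_completionI)
  then show False using open_not_negligible assms by blast
qed

text \<open>
  The inequality assumed here says that \<open>H - F\<close> is at least as good as \<open>H\<close>; the strict optimality of \<open>H\<close>
  forces \<open>F\<close> to be null.  In the proof \<open>P\<close> and \<open>N\<close> are the outward and inward displacements, and \<open>a\<close>,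
  \<open>b\<close>, \<open>c\<close> are the densities in \<open>h\<close> of the interaction of \<open>F\<close> with \<open>- F\<close>, \<open>H - F\<close> and \<open>- H\<close>.
\<close>

lemma half_space_defect_null:
  fixes k :: "'n::finite"
  assumes dim: "CARD('n) \<ge> 2"
    and K[measurable]: "K \<in> borel_measurable borel" and even: "\<And>h. K (- h) = K h"
    and Kpos: "\<And>h. K h > 0"
    and K_int: "integrable lebesgue (\<lambda>h. K h * min 1 (norm h))"
    and H: "coordinate_half_space k s H" and s: "s \<noteq> 0"
    and F: "F \<in> sets lebesgue" "F \<subseteq> unit_cube \<inter> H"
    and le: "interaction K (H - F) F \<le> interaction K (- H) F"
  shows "F \<in> null_sets lebesgue"
proof -
  note Hm = coordinate_half_space_lebesgue[OF H]
  have m: "- H \<in> sets lebesgue" "- F \<in> sets lebesgue" "H - F \<in> sets lebesgue"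
    using Hm F by (auto simp: Compl_in_sets_lebesgue)
  note [measurable] = borel_measurable_overlap[OF m(1) F(1)]
    borel_measurable_overlap[OF m(2) F(1)] borel_measurable_overlap[OF m(3) F(1)]
  define P N :: "(real ^ 'n) set" where "P = {h. s * h $ k > 0}" and "N = {h. s * h $ k < 0}"
  have [measurable]: "P \<in> sets borel" "N \<in> sets borel" by (auto simp: P_def N_def)
  define a b c where "a h = ennreal (K h) * overlap (- F) F h"
    and "b h = ennreal (K h) * overlap (H - F) F h"
    and "c h = ennreal (K h) * overlap (- H) F h" for h
  have [measurable]: "a \<in> borel_measurable borel" "b \<in> borel_measurable borel"
    "c \<in> borel_measurable borel"
    unfolding a_def b_def c_def by measurable
  have stay: "x + h \<in> H" if "x \<in> F" "h \<notin> P" for x h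
    using H F(2) that by (auto simp: coordinate_half_space_def P_def distrib_left)
  have c0: "c h = 0" if "h \<notin> P" for h
  proof -
    have "{x \<in> F. x + h \<in> - H} = {}" using stay that by auto
    then show ?thesis by (simp only: c_def overlap_def) simp
  qed
  have abc: "a h = b h + c h" for h
  proof -
    have "- F = (H - F) \<union> - H" using F(2) by auto
    moreover have "(H - F) \<inter> - H = {}" by auto
    ultimately show ?thesis
      using overlap_Un_left[OF m(3,1) F(1), of h] by (simp add: a_def b_def c_def distrib_left)
  qed
  have "emeasure lebesgue F \<le> emeasure lebesgue (unit_cube :: (real ^ 'n) set)"
    using F(2) by (intro emeasure_mono unit_cube_lebesgue) auto
  also have "\<dots> \<le> ennreal (2 * min 1 1)"
  proof (rule emeasure_unit_cube_slab[where k = k])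
    fix x :: "real ^ 'n" assume x: "x \<in> unit_cube"
    then have "- 1/2 < x $ k \<and> x $ k < 1/2" by (simp add: unit_cube_def)
    then show "x \<in> unit_cube \<and> \<bar>x $ k\<bar> \<le> 1" using x by auto
  qed simp
  finally have "emeasure lebesgue F < \<infinity>" by (simp add: le_less_trans)
  then have a_even: "a (- h) = a h" for h
    using overlap_complement_even[OF F(1)] by (simp add: a_def even)
  have C: "interaction K (- H) F = (\<integral>\<^sup>+h. c h \<partial>lborel)"
    by (simp add: interaction_eq_overlap_integral[OF K m(1) F(1)] c_def)
  have C_fin: "(\<integral>\<^sup>+h. c h \<partial>lborel) < \<infinity>"
    using interaction_half_space_finite[OF K Kpos K_int H s F] C by simp
  (* Reflecting h turns inward into outward displacements; only the latter can reach - H. *)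
  have "(\<integral>\<^sup>+h. b h * indicator N h \<partial>lborel) = (\<integral>\<^sup>+h. a h * indicator N h \<partial>lborel)"
    by (intro nn_integral_cong) (auto simp: abc c0 N_def P_def indicator_def)
  also have "\<dots> = (\<integral>\<^sup>+h. a (- h) * indicator N (- h) \<partial>lborel)"
    by (rule nn_integral_lborel_reflect[symmetric]) measurable
  also have "\<dots> = (\<integral>\<^sup>+h. a h * indicator P h \<partial>lborel)"
    by (intro nn_integral_cong) (auto simp: a_even N_def P_def indicator_def)
  also have "\<dots> = (\<integral>\<^sup>+h. b h * indicator P h + c h \<partial>lborel)"
    by (intro nn_integral_cong) (auto simp: abc c0 indicator_def)
  also have "\<dots> = (\<integral>\<^sup>+h. b h * indicator P h \<partial>lborel) + (\<integral>\<^sup>+h. c h \<partial>lborel)"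
    by (rule nn_integral_add) measurable
  finally have bN: "(\<integral>\<^sup>+h. b h * indicator N h \<partial>lborel)
    = (\<integral>\<^sup>+h. b h * indicator P h \<partial>lborel) + (\<integral>\<^sup>+h. c h \<partial>lborel)" .
  have "(\<integral>\<^sup>+h. b h * indicator P h \<partial>lborel) + (\<integral>\<^sup>+h. b h * indicator N h \<partial>lborel)
      = (\<integral>\<^sup>+h. b h * indicator P h + b h * indicator N h \<partial>lborel)"
    by (rule nn_integral_add[symmetric]) measurable
  also have "\<dots> \<le> (\<integral>\<^sup>+h. b h \<partial>lborel)"
    by (intro nn_integral_mono) (auto simp: N_def P_def indicator_def)
  also have "\<dots> = interaction K (H - F) F"
    by (simp add: interaction_eq_overlap_integral[OF K m(3) F(1)] b_def)
  also have "\<dots> \<le> (\<integral>\<^sup>+h. c h \<partial>lborel)" using le C by simp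
  finally have "(\<integral>\<^sup>+h. c h \<partial>lborel) + ((\<integral>\<^sup>+h. b h * indicator P h \<partial>lborel)
      + (\<integral>\<^sup>+h. b h * indicator P h \<partial>lborel)) \<le> (\<integral>\<^sup>+h. c h \<partial>lborel) + 0"
    by (simp add: bN ac_simps)
  then have "(\<integral>\<^sup>+h. b h * indicator P h \<partial>lborel) = 0"
    using C_fin unfolding ennreal_add_left_cancel_le by auto
  then have AE0: "AE h in lborel. b h * indicator P h = 0"
    by (subst (asm) nn_integral_0_iff_AE) measurable
  (* A second coordinate direction, along which one can leave the cube without leaving H. *)
  obtain j where j: "j \<noteq> k"
  proof (rule ccontr)
    assume "\<not> thesis"
    then have "(UNIV :: 'n set) = {k}" using that by auto
    then have "CARD('n) = card {k}" by (rule arg_cong)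
    then show False using dim by simp
  qed
  have null: "{x \<in> F. s * x $ k < - d} \<in> null_sets lebesgue" if d: "d > 0" for d
  proof -
    (* Such an h moves every point of the cube out of the cube sideways, and points of H deeper
       than d stay in H; so all of these deep points of F are counted by the overlap at h. *)
    let ?O = "{h :: real ^ 'n. 1 < h $ j \<and> 0 < s * h $ k \<and> s * h $ k < d}"
    have "open ?O"
      by (intro open_Collect_conj open_Collect_less continuous_intros)
    moreover have "(\<chi> i. if i = j then 2 else d / (2 * s)) \<in> ?O"
      using j s d by simp
    ultimately obtain h where h: "h \<in> ?O" "b h * indicator P h = 0"
      using AE_lborel_open_ex[OF AE0, of ?O] by blast
    then have "overlap (H - F) F h = 0"
      using Kpos[of h] by (auto simp: b_def P_def)
    then have "{x \<in> F. x + h \<in> H - F} \<in> null_sets lebesgue"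
      using overlap_set_measurable[OF m(3) F(1)] by (simp add: overlap_def null_sets_def)
    moreover have "{x \<in> F. s * x $ k < - d} \<subseteq> {x \<in> F. x + h \<in> H - F}"
    proof safe
      fix x assume x: "x \<in> F" "s * x $ k < - d"
      then have "- 1/2 < x $ j" using F(2) by (auto simp: unit_cube_def)
      then have "\<not> (x + h) $ j < 1/2" using h(1) by simp
      then show "x + h \<in> F \<Longrightarrow> False" using F(2) by (auto simp: unit_cube_def)
      show "x + h \<in> H"
        using H x h(1) by (auto simp: coordinate_half_space_def distrib_left)
    qed
    ultimately show ?thesis by (rule null_sets_completion_subset[rotated])
  qed
  (* What is left of F as the depth d tends to 0 lies on the bounding hyperplane. *)
  have "{x :: real ^ 'n. x $ k = 0} \<in> null_sets lebesgue"
    using negligible_standard_hyperplane_cart negligible_iff_null_sets by blast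
  moreover have "(\<Union>n. {x \<in> F. s * x $ k < - inverse (real (Suc n))}) \<in> null_sets lebesgue"
    by (intro null_sets_UN null) simp
  ultimately have "{x. x $ k = 0} \<union> (\<Union>n. {x \<in> F. s * x $ k < - inverse (real (Suc n))})
      \<in> null_sets lebesgue"
    by (rule null_sets.Un)
  moreover have "F \<subseteq> {x. x $ k = 0} \<union> (\<Union>n. {x \<in> F. s * x $ k < - inverse (real (Suc n))})"
  proof
    fix x assume x: "x \<in> F"
    then have "s * x $ k \<le> 0" using F(2) H by (auto simp: coordinate_half_space_def)
    then consider "x $ k = 0" | "0 < - (s * x $ k)" using s by (cases "s * x $ k = 0") auto
    then show "x \<in> {x. x $ k = 0} \<union> (\<Union>n. {x \<in> F. s * x $ k < - inverse (real (Suc n))})"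
    proof cases
      case 2
      then obtain n where "inverse (real (Suc n)) < - (s * x $ k)" using reals_Archimedean by blast
      then have "s * x $ k < - inverse (real (Suc n))" by linarith
      then show ?thesis using x by blast
    qed simp
  qed
  ultimately show ?thesis by (rule null_sets_completion_subset[rotated])
qed

section \<open>One-sided conditions and minimisers\<close>

text \<open>
  The test set is the defect \<open>H - E\<close> itself.  Replacing \<open>E\<close> by the smaller \<open>H \<inter> E\<close> on the left and
  \<open>- E \<inter> - H\<close> by the larger \<open>- H\<close> on the right only weakens the condition.
\<close>

lemma half_space_subset_of_outer_condition:
  fixes k :: "'n::finite"
  assumes dim: "CARD('n) \<ge> 2"
    and K: "K \<in> borel_measurable borel" and even: "\<And>h. K (- h) = K h"
    and Kpos: "\<And>h. K h > 0"
    and K_int: "integrable lebesgue (\<lambda>h. K h * min 1 (norm h))"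
    and H: "coordinate_half_space k s H" and s: "s \<noteq> 0"
    and E: "E \<in> sets lebesgue"
    and outer: "outer_condition K unit_cube E" and sub: "H \<inter> - unit_cube \<subseteq> E"
  shows "H - E \<in> null_sets lebesgue"
proof (rule half_space_defect_null[OF dim K even Kpos K_int H s])
  show F: "H - E \<in> sets lebesgue" using coordinate_half_space_lebesgue[OF H] E by auto
  show "H - E \<subseteq> unit_cube \<inter> H" using sub by auto
  have "interaction K (H - (H - E)) (H - E) \<le> interaction K E (H - E)"
    by (rule interaction_mono) auto
  also have "\<dots> \<le> interaction K (- E \<inter> - (H - E)) (H - E)"
    using outer F sub unfolding outer_condition_def by blast
  also have "\<dots> \<le> interaction K (- H) (H - E)"
    by (rule interaction_mono) auto
  finally show "interaction K (H - (H - E)) (H - E) \<le> interaction K (- H) (H - E)" .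
qed

lemma nonlocal_per_Compl:
  fixes E U :: "(real ^ 'n) set"
  assumes K: "K \<in> borel_measurable borel" and even: "\<And>h. K (- h) = K h"
    and m: "E \<in> sets lebesgue" "U \<in> sets lebesgue"
  shows "nonlocal_per K (- E) U = nonlocal_per K E U"
proof -
  have [simp]: "- E \<in> sets lebesgue" "- U \<in> sets lebesgue"
    using m by (auto simp: Compl_in_sets_lebesgue)
  have "interaction K (- E \<inter> U) (E \<inter> U) = interaction K (E \<inter> U) (- E \<inter> U)"
    "interaction K (- E \<inter> U) (E \<inter> - U) = interaction K (E \<inter> - U) (- E \<inter> U)"
    "interaction K (- E \<inter> - U) (E \<inter> U) = interaction K (E \<inter> U) (- E \<inter> - U)"
    using m by (auto intro!: interaction_commute[OF K even] sets.Int)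
  then show ?thesis by (simp add: nonlocal_per_def add_ac)
qed

text \<open>
  Adding \<open>F \<subseteq> - E \<inter> U\<close> to \<open>E\<close> trades the interaction of \<open>F\<close> with \<open>E\<close> for that with the rest of \<open>- E\<close>,
  and leaves the remaining interactions \<open>R\<close> unchanged: all pairs with one point in \<open>F \<subseteq> U\<close> are counted
  by the perimeter in \<open>U\<close>.  Finiteness of the perimeter of \<open>E\<close> allows \<open>R\<close> to be cancelled.
\<close>

lemma outer_condition_of_minimal:
  fixes E U :: "(real ^ 'n) set"
  assumes K: "K \<in> borel_measurable borel" and even: "\<And>h. K (- h) = K h"
    and m: "E \<in> sets lebesgue" "U \<in> sets lebesgue"
    and fin: "nonlocal_per K E U < \<infinity>"
    and min: "\<And>F. F \<in> sets lebesgue \<Longrightarrow> F \<subseteq> - E \<inter> U \<Longrightarrow> nonlocal_per K E U \<le> nonlocal_per K (E \<union> F) U"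
  shows "outer_condition K U E"
  unfolding outer_condition_def
proof (intro ballI impI)
  fix F assume F: "F \<in> sets lebesgue" "F \<subseteq> - E \<inter> U"
  have [simp]: "- E \<in> sets lebesgue" "- U \<in> sets lebesgue" "- F \<in> sets lebesgue"
    using m F by (auto simp: Compl_in_sets_lebesgue)
  define A B V W where "A = E \<inter> U" and "B = E \<inter> - U" and "V = - E \<inter> - U" and "W = - E \<inter> - F \<inter> U"
  have mm: "A \<in> sets lebesgue" "B \<in> sets lebesgue" "V \<in> sets lebesgue" "W \<in> sets lebesgue"
    using m F by (auto simp: A_def B_def V_def W_def)
  have sets: "- E \<inter> U = F \<union> W" "- E \<inter> - U = V" "E \<inter> U = A" "E \<inter> - U = B"
    "(E \<union> F) \<inter> U = A \<union> F" "(E \<union> F) \<inter> - U = B" "- (E \<union> F) \<inter> U = W" "- (E \<union> F) \<inter> - U = V"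
    "E = A \<union> B" "- E \<inter> - F = W \<union> V"
    and disj: "F \<inter> W = {}" "A \<inter> F = {}" "A \<inter> B = {}" "W \<inter> V = {}"
    using F(2) by (auto simp: A_def B_def V_def W_def)
  note addr = interaction_Un_right[OF K even] and addl = interaction_Un_left[OF K]
  define R where "R = interaction K A W + interaction K A V + interaction K B W"
  have EF: "interaction K E F = interaction K A F + interaction K B F"
    using addl[OF mm(1,2) F(1) disj(3)] sets(9) by simp
  have perE: "nonlocal_per K E U = R + interaction K E F"
    unfolding nonlocal_per_def sets(1-4) R_def EF
    by (simp add: addr mm F disj add_ac)
  have perG: "nonlocal_per K (E \<union> F) U = R + interaction K (- E \<inter> - F) F"
    unfolding nonlocal_per_def sets(5-8,10) R_def
    using interaction_commute[OF K even mm(3) F(1)] interaction_commute[OF K even mm(4) F(1)]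
    by (simp add: mm F disj addl add_ac)
  have "R \<noteq> top" using fin perE by auto
  then show "interaction K E F \<le> interaction K (- E \<inter> - F) F"
    using min[OF F] unfolding perE perG by (simp add: ennreal_add_left_cancel_le)
qed

lemma nonlocal_per_half_space_finite:
  fixes k :: "'n::finite"
  assumes K: "K \<in> borel_measurable borel" and even: "\<And>h. K (- h) = K h"
    and Kpos: "\<And>h. K h > 0"
    and K_int: "integrable lebesgue (\<lambda>h. K h * min 1 (norm h))"
    and H: "coordinate_half_space k s H" "coordinate_half_space k t (- H)" and st: "s \<noteq> 0" "t \<noteq> 0"
  shows "nonlocal_per K H unit_cube < \<infinity>"
proof -
  let ?U = "unit_cube :: (real ^ 'n) set"
  note Um = unit_cube_lebesgue[where 'n = 'n]
  have m[simp]: "H \<in> sets lebesgue" "- H \<in> sets lebesgue" "?U \<in> sets lebesgue" "- ?U \<in> sets lebesgue"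
    using coordinate_half_space_lebesgue[OF H(1)] Um by (auto simp: Compl_in_sets_lebesgue)
  note fin = interaction_half_space_finite[OF K Kpos K_int]
  have 1: "interaction K (- H) (H \<inter> ?U) < \<infinity>"
    by (rule fin[OF H(1) st(1)]) auto
  have 2: "interaction K H (- H \<inter> ?U) < \<infinity>"
    using fin[OF H(2) st(2), of "- H \<inter> ?U"] sets.Int[OF m(2,3)] by simp
  have "interaction K (H \<inter> ?U) (- H \<inter> ?U) < \<infinity>"
    by (rule le_less_trans[OF interaction_mono 2]) auto
  moreover have "interaction K (H \<inter> ?U) (- H \<inter> - ?U) < \<infinity>"
  proof (subst interaction_commute[OF K even])
    show "interaction K (- H \<inter> - ?U) (H \<inter> ?U) < \<infinity>"
      by (rule le_less_trans[OF interaction_mono 1]) auto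
  qed (auto intro!: sets.Int)
  moreover have "interaction K (H \<inter> - ?U) (- H \<inter> ?U) < \<infinity>"
    by (rule le_less_trans[OF interaction_mono 2]) auto
  ultimately show ?thesis by (simp add: nonlocal_per_def)
qed

lemma inner_condition_iff_outer_condition_Compl:
  "inner_condition K U E \<longleftrightarrow> outer_condition K U (- E)"
  by (simp add: inner_condition_def outer_condition_def)

theorem proposition2p11:
  fixes k :: "'n::finite"
    and Kbar :: "real \<Rightarrow> real"
    and K :: "real ^ 'n \<Rightarrow> real"
    and E H U :: "(real ^ 'n) set"
  assumes dim: "CARD('n) \<ge> 2"
    and H_def: "H = half_space k"
    and U_def: "U = unit_cube"
    and K_radial: "\<And>h. K h = Kbar (norm h)"
    and Kbar_nonneg: "\<And>r. r \<ge> 0 \<Longrightarrow> Kbar r \<ge> 0"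
    and Kbar_meas: "Kbar \<in> borel_measurable (lebesgue_on {0..})"
    and Kbar_decr: "strict_antimono_on {0..} Kbar"
    and K_int: "integrable lebesgue (\<lambda>h. K h * min 1 (norm h))"
    and E_meas: "E \<in> sets lebesgue"
  shows
    "(outer_condition K U E \<and> H \<inter> - U \<subseteq> E \<longrightarrow> H - E \<in> null_sets lebesgue) \<and>
     (inner_condition K U E \<and> E \<inter> - U \<subseteq> H \<longrightarrow> E - H \<in> null_sets lebesgue) \<and>
     (outer_condition K U E \<and> - H \<inter> - U \<subseteq> E \<longrightarrow> - H - E \<in> null_sets lebesgue) \<and>
     (inner_condition K U E \<and> E \<inter> - U \<subseteq> - H \<longrightarrow> E - - H \<in> null_sets lebesgue) \<and>
     (is_arg_min (\<lambda>F. nonlocal_per K F U) (\<lambda>F. F \<in> sets lebesgue \<and> F \<inter> - U = H \<inter> - U) E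
        \<longrightarrow> sym_diff E H \<in> null_sets lebesgue)"
  proof -
  (* A monotone function is Borel, so K is Borel and not merely Lebesgue measurable; the cut-off
     at 0 makes the profile monotone on the whole line. *)
  have "mono (\<lambda>r. - Kbar (max 0 r))"
  proof
    fix x y :: real assume "x \<le> y"
    then show "- Kbar (max 0 x) \<le> - Kbar (max 0 y)"
      using monotone_onD[OF Kbar_decr, of "max 0 x" "max 0 y"]
      by (cases "max 0 x = max 0 y") (auto simp: max_def split: if_splits)
  qed
  then have "(\<lambda>h :: real ^ 'n. - Kbar (max 0 (norm h))) \<in> borel_measurable borel"
    by (rule measurable_compose[OF borel_measurable_norm borel_measurable_mono,
          where g = "\<lambda>r. - Kbar (max 0 r)"])
  then have "(\<lambda>h :: real ^ 'n. - (- Kbar (max 0 (norm h)))) \<in> borel_measurable borel"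
    by (rule borel_measurable_uminus)
  moreover have "K = (\<lambda>h. - (- Kbar (max 0 (norm h))))" using K_radial by auto
  ultimately have K: "K \<in> borel_measurable borel" by simp
  have even: "K (- h) = K h" for h by (simp add: K_radial)
  have Kpos: "K h > 0" for h
    using monotone_onD[OF Kbar_decr, of "norm h" "norm h + 1"] Kbar_nonneg[of "norm h + 1"]
    by (simp add: K_radial)
  have H: "coordinate_half_space k 1 H" and nH: "coordinate_half_space k (- 1) (- H)"
    by (auto simp: coordinate_half_space_def H_def half_space_def)
  note Hm = coordinate_half_space_lebesgue[OF H]
  note Um = unit_cube_lebesgue[where 'n = 'n]
  have nE_meas: "- E \<in> sets lebesgue" using E_meas by (simp add: Compl_in_sets_lebesgue)
  note sub = half_space_subset_of_outer_condition[OF dim K even Kpos K_int]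
  have i: "H - E \<in> null_sets lebesgue" if "outer_condition K U E" "H \<inter> - U \<subseteq> E"
    using sub[OF H _ E_meas] that by (simp add: U_def)
  have i': "- H - E \<in> null_sets lebesgue" if "outer_condition K U E" "- H \<inter> - U \<subseteq> E"
    using sub[OF nH _ E_meas] that by (simp add: U_def)
  have ii: "E - H \<in> null_sets lebesgue" if "inner_condition K U E" "E \<inter> - U \<subseteq> H"
  proof -
    have "- H - - E \<in> null_sets lebesgue"
      using that by (intro sub[OF nH _ nE_meas])
        (auto simp: U_def inner_condition_iff_outer_condition_Compl)
    moreover have "- H - - E = E - H" by auto
    ultimately show ?thesis by simp
  qed
  have ii': "E - - H \<in> null_sets lebesgue" if "inner_condition K U E" "E \<inter> - U \<subseteq> - H"
  proof -
    have "H - - E \<in> null_sets lebesgue"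
      using that by (intro sub[OF H _ nE_meas])
        (auto simp: U_def inner_condition_iff_outer_condition_Compl)
    moreover have "H - - E = E - - H" by auto
    ultimately show ?thesis by simp
  qed
  have "sym_diff E H \<in> null_sets lebesgue"
    if "is_arg_min (\<lambda>F. nonlocal_per K F U) (\<lambda>F. F \<in> sets lebesgue \<and> F \<inter> - U = H \<inter> - U) E"
  proof -
    have EU: "E \<inter> - U = H \<inter> - U"
      and min: "nonlocal_per K E U \<le> nonlocal_per K F U"
      if "F \<in> sets lebesgue" "F \<inter> - U = H \<inter> - U" for F
      using \<open>is_arg_min _ _ E\<close> that by (auto simp: is_arg_min_linorder)
    have EU: "E \<inter> - U = H \<inter> - U" using EU[OF Hm] by simp
    have perC: "nonlocal_per K (- F) U = nonlocal_per K F U" if "F \<in> sets lebesgue" for F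
      using nonlocal_per_Compl[OF K even that Um] by (simp add: U_def)
    have "nonlocal_per K H U < \<infinity>"
      using nonlocal_per_half_space_finite[OF K even Kpos K_int H nH] by (simp add: U_def)
    then have fin: "nonlocal_per K E U < \<infinity>" using min[OF Hm] by simp
    have "outer_condition K U E"
    proof (rule outer_condition_of_minimal[OF K even E_meas _ fin])
      show "U \<in> sets lebesgue" using Um U_def by simp
      fix F assume F: "F \<in> sets lebesgue" "F \<subseteq> - E \<inter> U"
      then show "nonlocal_per K E U \<le> nonlocal_per K (E \<union> F) U"
        using EU E_meas by (intro min) (auto intro: sets.Un)
    qed
    moreover have "outer_condition K U (- E)"
    proof (rule outer_condition_of_minimal[OF K even nE_meas])
      show "U \<in> sets lebesgue" using Um U_def by simp
      show "nonlocal_per K (- E) U < \<infinity>" using fin perC E_meas by simp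
      fix F assume F: "F \<in> sets lebesgue" "F \<subseteq> - (- E) \<inter> U"
      then have "E - F \<in> sets lebesgue" "(E - F) \<inter> - U = H \<inter> - U"
        using EU E_meas by auto
      moreover have "- E \<union> F = - (E - F)" by auto
      ultimately show "nonlocal_per K (- E) U \<le> nonlocal_per K (- E \<union> F) U"
        using min[of "E - F"] perC[OF E_meas] perC[of "E - F"] by simp
    qed
    ultimately have "H - E \<in> null_sets lebesgue" "E - H \<in> null_sets lebesgue"
      using i ii EU by (auto simp: inner_condition_iff_outer_condition_Compl)
    then show ?thesis by (intro null_sets.Un)
  qed
  then show ?thesis using i i' ii ii' by blast
qed

end
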